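(* Let $\mathfrak{A}$ be a separable unital $C^*$-algebra and let $K\subset\mathfrak{A}$ be a compact set generating $\mathfrak{A}$. Then $(\operatorname{Rep}(\mathfrak{A}),d_K)$ is a complete metric space.
   Context: A set $K\subset\mathfrak{A}$ generates the unital $C^*$-algebra $\mathfrak{A}$ if the smallest $C^*$-subalgebra of $\mathfrak{A}$ containing $K\cup\{1\}$ is $\mathfrak{A}$. $\operatorname{Rep}(\mathfrak{A})$ denotes the set of all unital $*$-representations $\pi:\mathfrak{A}\to B(\ell^2)$ (so $\pi(1)=I$), where $B(\ell^2)$ is the algebra of bounded operators on $\ell^2=\ell^2(\mathbb{N})$. For $\pi_1,\pi_2\in\operatorname{Rep}(\mathfrak{A})$, $d_K(\pi_1,\pi_2)=\sup_{a\in K}\|\pi_1(a)-\pi_2(a)\|$. *)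

theory Defs
  imports "HOL-Analysis.Analysis"
begin

section \<open>Unital C*-algebras\<close>

class scaleC =
  fixes scaleC :: "complex \<Rightarrow> 'a \<Rightarrow> 'a"  (infixr \<open>*\<^sub>C\<close> 75)

class complex_normed_vector = real_normed_vector + scaleC +
  assumes scaleC_add_right: "c *\<^sub>C (x + y) = c *\<^sub>C x + c *\<^sub>C y"
    and scaleC_add_left: "(c + d) *\<^sub>C x = c *\<^sub>C x + d *\<^sub>C x"
    and scaleC_scaleC: "c *\<^sub>C d *\<^sub>C x = (c * d) *\<^sub>C x"
    and scaleR_scaleC: "r *\<^sub>R x = complex_of_real r *\<^sub>C x"
    and norm_scaleC: "norm (c *\<^sub>C x) = cmod c * norm x"

text \<open>The unit is taken from \<^class>\<open>monoid_mult\<close> rather than from \<^class>\<open>real_normed_algebra_1\<close>,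
  so that the zero algebra is allowed; in every other algebra the C*-identity gives \<open>norm 1 = 1\<close>.\<close>

class unital_cstar_algebra =
  complex_normed_vector + real_normed_algebra + banach + monoid_mult +
  fixes star :: "'a \<Rightarrow> 'a"
  assumes scaleC_mult_left: "(c *\<^sub>C x) * y = c *\<^sub>C (x * y)"
    and scaleC_mult_right: "x * (c *\<^sub>C y) = c *\<^sub>C (x * y)"
    and star_star: "star (star x) = x"
    and star_add: "star (x + y) = star x + star y"
    and star_scaleC: "star (c *\<^sub>C x) = cnj c *\<^sub>C star x"
    and star_mult: "star (x * y) = star y * star x"
    and cstar_identity: "norm (star x * x) = (norm x)\<^sup>2"

text \<open>Subalgebras are not required to contain the unit.\<close>

definition cstar_subalgebra :: "'a::unital_cstar_algebra set \<Rightarrow> bool" where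
  "cstar_subalgebra B \<longleftrightarrow>
     0 \<in> B \<and> (\<forall>x\<in>B. \<forall>y\<in>B. x + y \<in> B) \<and> (\<forall>c. \<forall>x\<in>B. c *\<^sub>C x \<in> B) \<and>
     (\<forall>x\<in>B. \<forall>y\<in>B. x * y \<in> B) \<and> (\<forall>x\<in>B. star x \<in> B) \<and> closed B"

definition cstar_generates :: "'a::unital_cstar_algebra set \<Rightarrow> bool" where
  "cstar_generates K \<longleftrightarrow> cstar_subalgebra hull (K \<union> {1}) = UNIV"


section \<open>The Hilbert space of square-summable complex sequences\<close>

typedef ell2 = "{x :: nat \<Rightarrow> complex. summable (\<lambda>n. (cmod (x n))\<^sup>2)}"
  morphisms ell2_nth Abs_ell2
  by (rule exI[of _ "\<lambda>_. 0"]) simp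

setup_lifting type_definition_ell2

lemma ell2_summable: "summable (\<lambda>n. (cmod (ell2_nth x n))\<^sup>2)"
  using ell2_nth[of x] by simp

lemma ell2_eqI: "(\<And>n. ell2_nth x n = ell2_nth y n) \<Longrightarrow> x = y"
  by (simp add: ell2_nth_inject[symmetric] fun_eq_iff)

lemma square_summable_add:
  fixes x y :: "nat \<Rightarrow> complex"
  assumes x: "summable (\<lambda>n. (cmod (x n))\<^sup>2)" and y: "summable (\<lambda>n. (cmod (y n))\<^sup>2)"
  shows "summable (\<lambda>n. (cmod (x n + y n))\<^sup>2)"
    and "sqrt (\<Sum>n. (cmod (x n + y n))\<^sup>2)
           \<le> sqrt (\<Sum>n. (cmod (x n))\<^sup>2) + sqrt (\<Sum>n. (cmod (y n))\<^sup>2)"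
proof -
  let ?R = "sqrt (\<Sum>n. (cmod (x n))\<^sup>2) + sqrt (\<Sum>n. (cmod (y n))\<^sup>2)"
  have R0: "0 \<le> ?R"
    by (intro add_nonneg_nonneg real_sqrt_ge_zero suminf_nonneg x y) auto
  have part: "(\<Sum>n<N. (cmod (x n + y n))\<^sup>2) \<le> ?R\<^sup>2" for N
  proof -
    have "L2_set (\<lambda>n. cmod (x n + y n)) {..<N} \<le> L2_set (\<lambda>n. cmod (x n) + cmod (y n)) {..<N}"
      by (rule L2_set_mono) (auto intro: norm_triangle_ineq)
    also have "\<dots> \<le> L2_set (\<lambda>n. cmod (x n)) {..<N} + L2_set (\<lambda>n. cmod (y n)) {..<N}"
      by (rule L2_set_triangle_ineq)
    also have "\<dots> \<le> ?R"
      unfolding L2_set_def by (intro add_mono real_sqrt_le_mono sum_le_suminf x y) auto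
    finally show ?thesis
      unfolding L2_set_def by (rule sqrt_le_D)
  qed
  show s: "summable (\<lambda>n. (cmod (x n + y n))\<^sup>2)"
    by (rule summableI_nonneg_bounded[where x = "?R\<^sup>2"]) (auto intro: part)
  have "(\<Sum>n. (cmod (x n + y n))\<^sup>2) \<le> ?R\<^sup>2"
    by (rule suminf_le_const[OF s part])
  then show "sqrt (\<Sum>n. (cmod (x n + y n))\<^sup>2) \<le> ?R"
    by (rule real_le_lsqrt[OF R0])
qed

lemma square_summable_cmult:
  fixes x :: "nat \<Rightarrow> complex"
  shows "summable (\<lambda>n. (cmod (x n))\<^sup>2) \<Longrightarrow> summable (\<lambda>n. (cmod (c * x n))\<^sup>2)"
  by (simp add: norm_mult power_mult_distrib summable_mult)

instantiation ell2 :: complex_normed_vector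
begin

lift_definition zero_ell2 :: ell2 is "\<lambda>_. 0" by simp

lift_definition plus_ell2 :: "ell2 \<Rightarrow> ell2 \<Rightarrow> ell2" is "\<lambda>x y n. x n + y n"
  by (rule square_summable_add)

lift_definition uminus_ell2 :: "ell2 \<Rightarrow> ell2" is "\<lambda>x n. - x n" by simp

definition minus_ell2 :: "ell2 \<Rightarrow> ell2 \<Rightarrow> ell2" where "x - y = x + - y" for x y :: ell2

lift_definition scaleC_ell2 :: "complex \<Rightarrow> ell2 \<Rightarrow> ell2" is "\<lambda>c x n. c * x n"
  by (rule square_summable_cmult)

definition scaleR_ell2 :: "real \<Rightarrow> ell2 \<Rightarrow> ell2" where
  "r *\<^sub>R x = complex_of_real r *\<^sub>C x" for x :: ell2

lift_definition norm_ell2 :: "ell2 \<Rightarrow> real" is "\<lambda>x. sqrt (\<Sum>n. (cmod (x n))\<^sup>2)" .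

definition dist_ell2 :: "ell2 \<Rightarrow> ell2 \<Rightarrow> real" where "dist x y = norm (x - y)" for x y :: ell2

definition sgn_ell2 :: "ell2 \<Rightarrow> ell2" where "sgn x = inverse (norm x) *\<^sub>R x" for x :: ell2

definition uniformity_ell2 :: "(ell2 \<times> ell2) filter" where
  "uniformity_ell2 = (INF e\<in>{0<..}. principal {(x, y). dist x y < e})"

definition open_ell2 :: "ell2 set \<Rightarrow> bool" where
  "open_ell2 U \<longleftrightarrow> (\<forall>x\<in>U. \<forall>\<^sub>F (x', y) in uniformity. x' = x \<longrightarrow> y \<in> U)"

instance
proof
  fix x y z :: ell2 and c d :: complex and r s :: real
  show "x + y + z = x + (y + z)" "x + y = y + x" "0 + x = x" "- x + x = 0"
    by (transfer; simp add: algebra_simps)+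
  show "x - y = x + - y"
    by (rule minus_ell2_def)
  show C: "c *\<^sub>C (x + y) = c *\<^sub>C x + c *\<^sub>C y" "(c + d) *\<^sub>C x = c *\<^sub>C x + d *\<^sub>C x"
    "c *\<^sub>C d *\<^sub>C x = (c * d) *\<^sub>C x" for c d and x y :: ell2
    by (transfer; simp add: algebra_simps)+
  show R: "r *\<^sub>R x = complex_of_real r *\<^sub>C x" for r and x :: ell2
    by (rule scaleR_ell2_def)
  show "r *\<^sub>R (x + y) = r *\<^sub>R x + r *\<^sub>R y" "(r + s) *\<^sub>R x = r *\<^sub>R x + s *\<^sub>R x"
    "r *\<^sub>R s *\<^sub>R x = (r * s) *\<^sub>R x"
    by (simp_all add: R C)
  show "1 *\<^sub>R x = x"
    unfolding scaleR_ell2_def by transfer simp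
  show N: "norm (c *\<^sub>C x) = cmod c * norm x" for c and x :: ell2
    by transfer (simp add: norm_mult power_mult_distrib suminf_mult real_sqrt_mult)
  show "norm (r *\<^sub>R x) = \<bar>r\<bar> * norm x"
    by (simp add: R N)
  show "norm x = 0 \<longleftrightarrow> x = 0"
    by transfer (simp add: suminf_eq_zero_iff fun_eq_iff)
  show "norm (x + y) \<le> norm x + norm y"
    by transfer (rule square_summable_add)
qed (auto simp: dist_ell2_def sgn_ell2_def uniformity_ell2_def open_ell2_def)

end

text \<open>The series converges absolutely, by the Cauchy-Schwarz inequality.\<close>

definition cinner_ell2 :: "ell2 \<Rightarrow> ell2 \<Rightarrow> complex" where
  "cinner_ell2 x y = (\<Sum>n. ell2_nth x n * cnj (ell2_nth y n))"


section \<open>Representations\<close>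

text \<open>\<^typ>\<open>ell2 \<Rightarrow>\<^sub>L ell2\<close> consists of the bounded real-linear maps, with the operator norm;
  the bounded operators are the complex-linear ones among them.\<close>

definition bounded_operators :: "(ell2 \<Rightarrow>\<^sub>L ell2) set" where
  "bounded_operators = {T. \<forall>c x. blinfun_apply T (c *\<^sub>C x) = c *\<^sub>C blinfun_apply T x}"

definition is_adjoint :: "(ell2 \<Rightarrow>\<^sub>L ell2) \<Rightarrow> (ell2 \<Rightarrow>\<^sub>L ell2) \<Rightarrow> bool" where
  "is_adjoint S T \<longleftrightarrow> (\<forall>x y. cinner_ell2 (T x) y = cinner_ell2 x (S y))"

definition Rep :: "('a::unital_cstar_algebra \<Rightarrow> (ell2 \<Rightarrow>\<^sub>L ell2)) set" where
  "Rep = {\<pi>. (\<forall>a. \<pi> a \<in> bounded_operators) \<and>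
             (\<forall>a b. \<pi> (a + b) = \<pi> a + \<pi> b) \<and>
             (\<forall>c a x. blinfun_apply (\<pi> (c *\<^sub>C a)) x = c *\<^sub>C blinfun_apply (\<pi> a) x) \<and>
             (\<forall>a b. \<pi> (a * b) = \<pi> a o\<^sub>L \<pi> b) \<and>
             (\<forall>a. is_adjoint (\<pi> (star a)) (\<pi> a)) \<and>
             \<pi> 1 = id_blinfun}"

text \<open>The supremum is taken in \<open>[0, \<infinity>]\<close>: it is then meaningful for arbitrary maps, as
  \<^const>\<open>Metric_space\<close> demands off the carrier, and it is \<open>0\<close> for empty \<open>K\<close>.\<close>

definition rep_dist ::
  "'a::unital_cstar_algebra set \<Rightarrow> ('a \<Rightarrow> (ell2 \<Rightarrow>\<^sub>L ell2)) \<Rightarrow> ('a \<Rightarrow> (ell2 \<Rightarrow>\<^sub>L ell2)) \<Rightarrow> ennreal"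
  where "rep_dist K \<pi>\<^sub>1 \<pi>\<^sub>2 = (SUP a\<in>K. ennreal (norm (\<pi>\<^sub>1 a - \<pi>\<^sub>2 a)))"

end

theory Submission
  imports Defs
begin

text \<open>
  Everything rests on the automatic contractivity of representations: \<open>\<parallel>\<pi>(a)\<parallel> \<le> \<parallel>a\<parallel>\<close> for every
  \<open>\<pi>\<close> in \<^const>\<open>Rep\<close>, although continuity is not part of the definition. If \<open>\<parallel>a\<parallel> < 1\<close>, then
  \<open>1 - a\<^sup>* a = b\<^sup>2\<close> for a self-adjoint \<open>b\<close>, whence
  \<open>\<parallel>x\<parallel>\<^sup>2 - \<parallel>\<pi>(a) x\<parallel>\<^sup>2 = \<langle>\<pi>(1 - a\<^sup>* a) x, x\<rangle> = \<parallel>\<pi>(b) x\<parallel>\<^sup>2 \<ge> 0\<close>, and the general case follows by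
  scaling. The square root needs no functional calculus: writing \<open>b = 1 - s\<close>, the equation becomes
  \<open>s = (a\<^sup>* a + s\<^sup>2) / 2\<close>, which Banach's fixed point theorem solves inside a closed set of
  self-adjoint elements (lemma \<open>sqrt_one_minus\<close>).

  Contractivity bounds \<open>\<parallel>\<pi>\<^sub>1(a) - \<pi>\<^sub>2(a)\<parallel>\<close> on the bounded set \<open>K\<close>, so \<open>d\<^sub>K\<close> is finite. It also makes
  two sets closed, hence C*-subalgebras: the set where two representations agree, and the set of
  all \<open>a\<close> for which a given sequence \<open>\<pi>\<^sub>n(a)\<close> is norm Cauchy. If \<open>d\<^sub>K(\<pi>\<^sub>1, \<pi>\<^sub>2) = 0\<close>, the
  first contains \<open>K\<close> and \<open>1\<close> and is therefore the whole algebra; if \<open>\<pi>\<^sub>n\<close> is Cauchy for \<open>d\<^sub>K\<close>,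
  the same is true of the second. In that case the operators \<open>\<pi>\<^sub>n(a)\<close> converge in norm for every \<open>a\<close>, because the operators on the
  complete space \<open>\<ell>\<^sup>2\<close> form a Banach space. All the algebraic identities defining a
  representation survive norm limits, and the convergence is uniform on \<open>K\<close>, since the sequence is
  uniformly Cauchy there.
\<close>

section \<open>The Hilbert space of square-summable sequences\<close>

lemma norm_ell2_eq: "norm x = sqrt (\<Sum>n. (cmod (ell2_nth x n))\<^sup>2)"
  by transfer simp

lemma L2_set_le_norm_ell2: "L2_set (\<lambda>n. cmod (ell2_nth x n)) {..<N} \<le> norm x"
  unfolding L2_set_def norm_ell2_eq
  by (intro real_sqrt_le_mono sum_le_suminf ell2_summable) auto

lemma cmod_ell2_nth_le: "cmod (ell2_nth x n) \<le> norm x"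
  by (rule order_trans[OF member_le_L2_set L2_set_le_norm_ell2[of _ "Suc n"]]) auto

lemma ell2_nth_add: "ell2_nth (x + y) n = ell2_nth x n + ell2_nth y n"
  by transfer simp

lemma ell2_nth_diff: "ell2_nth (x - y) n = ell2_nth x n - ell2_nth y n"
  unfolding minus_ell2_def by transfer simp

lemma ell2_nth_scaleC: "ell2_nth (c *\<^sub>C x) n = c * ell2_nth x n"
  by transfer simp

text \<open>Finite sections pass to the limit where the whole norm does not, and they control the
  norm from below; this is how coordinatewise limits of bounded sequences are handled.\<close>

lemma ell2_limit_of_bounded:
  fixes X :: "nat \<Rightarrow> ell2"
  assumes lim: "\<And>n. (\<lambda>m. ell2_nth (X m) n) \<longlonglongrightarrow> l n"
    and bound: "\<And>m. m \<ge> M \<Longrightarrow> norm (X m) \<le> e"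
  obtains y where "ell2_nth y = l" "norm y \<le> e"
proof -
  have "0 \<le> e"
    using bound[of M] norm_ge_zero[of "X M"] by linarith
  have part: "(\<Sum>n<N. (cmod (l n))\<^sup>2) \<le> e\<^sup>2" for N
  proof (rule LIMSEQ_le_const2)
    show "(\<lambda>m. \<Sum>n<N. (cmod (ell2_nth (X m) n))\<^sup>2) \<longlonglongrightarrow> (\<Sum>n<N. (cmod (l n))\<^sup>2)"
      by (intro tendsto_intros lim)
    have "(\<Sum>n<N. (cmod (ell2_nth (X m) n))\<^sup>2) \<le> e\<^sup>2" if "m \<ge> M" for m
      using order_trans[OF L2_set_le_norm_ell2[of "X m" N] bound[OF that]]
      unfolding L2_set_def by (rule sqrt_le_D)
    then show "\<exists>M. \<forall>m\<ge>M. (\<Sum>n<N. (cmod (ell2_nth (X m) n))\<^sup>2) \<le> e\<^sup>2"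
      by blast
  qed
  have s: "summable (\<lambda>n. (cmod (l n))\<^sup>2)"
    by (rule summableI_nonneg_bounded[where x = "e\<^sup>2"]) (auto intro: part)
  then have nth: "ell2_nth (Abs_ell2 l) = l"
    by (simp add: Abs_ell2_inverse)
  moreover have "norm (Abs_ell2 l) \<le> e"
    unfolding norm_ell2_eq nth
    by (rule real_le_lsqrt[OF \<open>0 \<le> e\<close>]) (rule suminf_le_const[OF s part])
  ultimately show thesis
    by (rule that)
qed

instance ell2 :: banach
proof
  fix X :: "nat \<Rightarrow> ell2"
  assume X: "Cauchy X"
  have "Cauchy (\<lambda>m. ell2_nth (X m) n)" for n
  proof (rule metric_CauchyI)
    fix e :: real
    assume "e > 0"
    with X obtain M where "\<forall>m\<ge>M. \<forall>k\<ge>M. dist (X m) (X k) < e"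
      unfolding Cauchy_def by blast
    then have "\<forall>m\<ge>M. \<forall>k\<ge>M. dist (ell2_nth (X m) n) (ell2_nth (X k) n) < e"
      unfolding dist_norm ell2_nth_diff[symmetric]
      by (meson cmod_ell2_nth_le order_le_less_trans)
    then show "\<exists>M. \<forall>m\<ge>M. \<forall>k\<ge>M. dist (ell2_nth (X m) n) (ell2_nth (X k) n) < e"
      by blast
  qed
  then obtain l where l: "\<And>n. (\<lambda>m. ell2_nth (X m) n) \<longlonglongrightarrow> l n"
    unfolding Cauchy_convergent_iff convergent_def by metis
  \<comment> \<open>Applied to \<open>X k - X m\<close> as \<open>m\<close> grows, the limit lemma gives square-summability of \<open>X k - l\<close>.
    That of \<open>l\<close> follows by subtraction.\<close>
  have dist_lim: "\<exists>y. ell2_nth y = (\<lambda>n. ell2_nth (X k) n - l n) \<and> norm y \<le> e"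
    if M: "\<forall>m\<ge>M. \<forall>k\<ge>M. dist (X m) (X k) < e" and k: "k \<ge> M" for M e k
  proof (rule ell2_limit_of_bounded)
    show "(\<lambda>m. ell2_nth (X k - X m) n) \<longlonglongrightarrow> ell2_nth (X k) n - l n" for n
      unfolding ell2_nth_diff by (intro tendsto_intros l)
    show "norm (X k - X m) \<le> e" if "m \<ge> M" for m
      using M k that by (auto simp: dist_norm less_imp_le)
  qed blast
  obtain M where "\<forall>m\<ge>M. \<forall>k\<ge>M. dist (X m) (X k) < 1"
    using X unfolding Cauchy_def by (meson zero_less_one)
  from dist_lim[OF this order_refl] obtain y where y: "ell2_nth y = (\<lambda>n. ell2_nth (X M) n - l n)"
    by blast
  have nth_lim: "ell2_nth (X M - y) n = l n" for n
    by (simp add: ell2_nth_diff y)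
  have "X \<longlonglongrightarrow> X M - y"
  proof (rule LIMSEQ_I)
    fix e :: real
    assume "e > 0"
    then obtain N where N: "\<forall>m\<ge>N. \<forall>k\<ge>N. dist (X m) (X k) < e / 2"
      using X unfolding Cauchy_def by (meson half_gt_zero)
    have "norm (X k - (X M - y)) < e" if k: "k \<ge> N" for k
    proof -
      from dist_lim[OF N k]
      obtain z where z: "ell2_nth z = (\<lambda>n. ell2_nth (X k) n - l n)" "norm z \<le> e / 2"
        by blast
      have "X k - (X M - y) = z"
        by (rule ell2_eqI) (simp only: ell2_nth_diff[of "X k"] nth_lim z)
      with z \<open>e > 0\<close> show ?thesis by simp
    qed
    then show "\<exists>N. \<forall>k\<ge>N. norm (X k - (X M - y)) < e" by blast
  qed
  then show "convergent X"
    unfolding convergent_def by blast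
qed

lemma cinner_ell2_abs_summable:
  "summable (\<lambda>n. cmod (ell2_nth x n * cnj (ell2_nth y n)))"
  and cinner_ell2_Cauchy_Schwarz: "cmod (cinner_ell2 x y) \<le> norm x * norm y"
proof -
  have part: "(\<Sum>n<N. cmod (ell2_nth x n * cnj (ell2_nth y n))) \<le> norm x * norm y" for N
  proof -
    have "(\<Sum>n<N. cmod (ell2_nth x n * cnj (ell2_nth y n)))
        \<le> L2_set (\<lambda>n. cmod (ell2_nth x n)) {..<N} * L2_set (\<lambda>n. cmod (ell2_nth y n)) {..<N}"
      using L2_set_mult_ineq[of "\<lambda>n. cmod (ell2_nth x n)" "\<lambda>n. cmod (ell2_nth y n)" "{..<N}"]
      by (simp add: norm_mult)
    also have "\<dots> \<le> norm x * norm y"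
      by (intro mult_mono L2_set_le_norm_ell2) auto
    finally show ?thesis .
  qed
  show s: "summable (\<lambda>n. cmod (ell2_nth x n * cnj (ell2_nth y n)))"
    by (rule summableI_nonneg_bounded[where x = "norm x * norm y"]) (auto intro: part)
  show "cmod (cinner_ell2 x y) \<le> norm x * norm y"
    unfolding cinner_ell2_def
    by (rule order_trans[OF summable_norm[OF s] suminf_le_const[OF s part]])
qed

lemmas cinner_ell2_summable = summable_norm_cancel[OF cinner_ell2_abs_summable]

interpretation cinner_ell2: bounded_bilinear cinner_ell2
proof
  fix x x' y y' :: ell2 and r :: real
  show "cinner_ell2 (x + x') y = cinner_ell2 x y + cinner_ell2 x' y"
    unfolding cinner_ell2_def suminf_add[OF cinner_ell2_summable cinner_ell2_summable]
    by (simp add: ell2_nth_add algebra_simps)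
  show "cinner_ell2 x (y + y') = cinner_ell2 x y + cinner_ell2 x y'"
    unfolding cinner_ell2_def suminf_add[OF cinner_ell2_summable cinner_ell2_summable]
    by (simp add: ell2_nth_add algebra_simps)
  show "cinner_ell2 (r *\<^sub>R x) y = r *\<^sub>R cinner_ell2 x y"
    unfolding cinner_ell2_def scaleR_conv_of_real suminf_mult[OF cinner_ell2_summable, symmetric]
    by (simp add: scaleR_ell2_def ell2_nth_scaleC mult.assoc)
  show "cinner_ell2 x (r *\<^sub>R y) = r *\<^sub>R cinner_ell2 x y"
    unfolding cinner_ell2_def scaleR_conv_of_real suminf_mult[OF cinner_ell2_summable, symmetric]
    by (simp add: scaleR_ell2_def ell2_nth_scaleC mult_ac)
  show "\<exists>K. \<forall>x y. norm (cinner_ell2 x y) \<le> norm x * norm y * K"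
    by (rule exI[of _ 1]) (simp add: cinner_ell2_Cauchy_Schwarz)
qed

lemma cinner_ell2_self: "cinner_ell2 x x = complex_of_real ((norm x)\<^sup>2)"
proof -
  have "(norm x)\<^sup>2 = (\<Sum>n. (cmod (ell2_nth x n))\<^sup>2)"
    unfolding norm_ell2_eq by (simp add: suminf_nonneg ell2_summable)
  then show ?thesis
    unfolding cinner_ell2_def complex_norm_square[symmetric]
    by (simp only: suminf_of_real[OF ell2_summable])
qed

lemma is_adjoint_diff:
  "is_adjoint S T \<Longrightarrow> is_adjoint S' T' \<Longrightarrow> is_adjoint (S - S') (T - T')"
  by (simp add: is_adjoint_def blinfun.diff_left cinner_ell2.diff_left cinner_ell2.diff_right)

lemma norm_adjoint_le:
  assumes "is_adjoint S T"
  shows "norm S \<le> norm T"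
proof (rule norm_blinfun_bound)
  fix y
  have "(norm (S y))\<^sup>2 = cmod (cinner_ell2 (S y) (S y))"
    by (simp add: cinner_ell2_self norm_power)
  also have "\<dots> = cmod (cinner_ell2 (T (S y)) y)"
    using assms by (simp add: is_adjoint_def)
  also have "\<dots> \<le> norm T * norm (S y) * norm y"
    by (rule order_trans[OF cinner_ell2_Cauchy_Schwarz])
      (intro mult_right_mono norm_blinfun norm_ge_zero)
  finally have "norm (S y) * norm (S y) \<le> norm (S y) * (norm T * norm y)"
    by (simp add: power2_eq_square mult_ac)
  then show "norm (S y) \<le> norm T * norm y"
    by (cases "norm (S y) = 0") (simp_all add: mult_le_cancel_left)
qed simp

section \<open>Square roots in C*-algebras\<close>

lemma star_one: "star (1 :: 'a::unital_cstar_algebra) = 1"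
  by (metis mult_1_right star_mult star_star)

lemma norm_star: "norm (star x) = norm (x :: 'a::unital_cstar_algebra)"
proof -
  have le: "norm y \<le> norm (star y)" for y :: 'a
  proof -
    have "norm y * norm y \<le> norm (star y) * norm y"
      using norm_mult_ineq[of "star y" y] by (simp add: cstar_identity power2_eq_square)
    then show ?thesis
      by (cases "norm y = 0") (simp_all add: mult_le_cancel_right)
  qed
  show ?thesis
    using le[of x] le[of "star x"] by (simp add: star_star)
qed

lemma bounded_linear_star: "bounded_linear (star :: 'a \<Rightarrow> 'a::unital_cstar_algebra)"
  by (rule bounded_linear_intro[where K = 1])
    (simp_all add: star_add scaleR_scaleC star_scaleC norm_star)

lemmas linear_star = bounded_linear.linear[OF bounded_linear_star]

text \<open>The substitution \<open>b = 1 - s\<close> turns \<open>b\<^sup>2 = 1 - h\<close> into the fixed point equation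
  \<open>s = (h + s\<^sup>2) / 2\<close>. The right-hand side maps the ball of radius \<open>q = \<parallel>h\<parallel>\<close> into itself because
  \<open>q\<^sup>2 \<le> q\<close>, and it contracts distances there by the factor \<open>q < 1\<close>, because
  \<open>s\<^sup>2 - t\<^sup>2 = s (s - t) + (s - t) t\<close>.\<close>

lemma sqrt_one_minus:
  fixes h :: "'a::unital_cstar_algebra"
  assumes h: "star h = h" and small: "norm h < 1"
  obtains b where "star b = b" "b * b = 1 - h"
proof -
  define q where "q = norm h"
  define S where "S = cball 0 q \<inter> {s :: 'a. star s = s}"
  define f where "f s = (1/2) *\<^sub>R (h + s * s)" for s :: 'a
  have q: "0 \<le> q" "q < 1"
    using small by (simp_all add: q_def)
  have "closed {s :: 'a. star s = s}"
    by (intro closed_Collect_eq linear_continuous_on bounded_linear_star continuous_on_id)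
  then have S: "complete S"
    unfolding S_def by (intro closed_Int closed_cball complete_eq_closed[THEN iffD2])
  have "0 \<in> S"
    using q by (simp add: S_def linear_0[OF linear_star])
  then have "S \<noteq> {}"
    by blast
  moreover have "f ` S \<subseteq> S"
  proof (rule image_subsetI)
    fix s
    assume "s \<in> S"
    then have s: "norm s \<le> q" "star s = s"
      by (simp_all add: S_def)
    have "norm (s * s) \<le> q * q"
      by (rule order_trans[OF norm_mult_ineq]) (intro mult_mono s q norm_ge_zero)
    also have "\<dots> \<le> q"
      using q by (simp add: mult_left_le)
    finally have "norm (h + s * s) \<le> q + q"
      by (intro order_trans[OF norm_triangle_ineq] add_mono) (simp_all add: q_def)
    then show "f s \<in> S"
      by (simp add: S_def f_def linear_scale[OF linear_star] star_add star_mult h s)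
  qed
  moreover have "dist (f s) (f t) \<le> q * dist s t" if "s \<in> S" "t \<in> S" for s t
  proof -
    have "f s - f t = (1/2) *\<^sub>R (s * (s - t) + (s - t) * t)"
      by (simp add: f_def algebra_simps)
    also have "norm \<dots> \<le> (1/2) * (norm s * norm (s - t) + norm (s - t) * norm t)"
      using norm_triangle_mono[OF norm_mult_ineq norm_mult_ineq, of s "s - t" "s - t" t]
      by simp
    also have "\<dots> \<le> (1/2) * (q * norm (s - t) + norm (s - t) * q)"
      using that by (intro mult_left_mono add_mono mult_right_mono) (simp_all add: S_def)
    finally show ?thesis
      by (simp add: dist_norm mult_ac)
  qed
  ultimately obtain s where s: "s \<in> S" "f s = s"
    using Banach_fix[OF S _ q] by blast
  then have "2 *\<^sub>R s = 2 *\<^sub>R f s"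
    by simp
  then have "s + s = h + s * s"
    by (simp add: f_def scaleR_2)
  then have "(1 - s) * (1 - s) = 1 - h"
    by (simp add: algebra_simps)
  moreover have "star (1 - s) = 1 - s"
    using s by (simp add: S_def linear_diff[OF linear_star] star_one)
  ultimately show thesis
    by (rule that[rotated])
qed

section \<open>Representations are contractive\<close>

context
  fixes \<pi> :: "'a::unital_cstar_algebra \<Rightarrow> (ell2 \<Rightarrow>\<^sub>L ell2)"
  assumes rep: "\<pi> \<in> Rep"
begin

lemma rep_add: "\<pi> (a + b) = \<pi> a + \<pi> b"
  and rep_mult: "\<pi> (a * b) = \<pi> a o\<^sub>L \<pi> b"
  and rep_one: "\<pi> 1 = id_blinfun"
  and rep_scaleC: "blinfun_apply (\<pi> (c *\<^sub>C a)) x = c *\<^sub>C \<pi> a x"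
  and rep_bounded_operators: "\<pi> a \<in> bounded_operators"
  and rep_star: "is_adjoint (\<pi> (star a)) (\<pi> a)"
  using rep by (simp_all add: Rep_def)

lemma rep_scaleR: "\<pi> (r *\<^sub>R a) = r *\<^sub>R \<pi> a"
  by (rule blinfun_eqI) (simp add: scaleR_scaleC rep_scaleC blinfun.scaleR_left)

lemma linear_rep: "linear \<pi>"
  by (rule linearI) (simp_all add: rep_add rep_scaleR)

lemma norm_rep_apply_sq: "(norm (\<pi> a x))\<^sup>2 = Re (cinner_ell2 (\<pi> (star a * a) x) x)"
proof -
  have "cinner_ell2 (\<pi> (star a * a) x) x = cinner_ell2 (\<pi> a x) (\<pi> a x)"
    using rep_star[of "star a"] by (simp add: rep_mult is_adjoint_def star_star)
  then show ?thesis
    by (simp add: cinner_ell2_self)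
qed

lemma norm_rep_apply_le_of_norm_less_one:
  assumes "norm a < 1"
  shows "norm (\<pi> a x) \<le> norm x"
proof -
  have "norm (star a * a) < 1"
    using assms by (simp add: cstar_identity power_less_one_iff)
  moreover have "star (star a * a) = star a * a"
    by (simp add: star_mult star_star)
  ultimately obtain b where b: "star b = b" "b * b = 1 - star a * a"
    by (blast intro: sqrt_one_minus)
  have "(norm x)\<^sup>2 - (norm (\<pi> a x))\<^sup>2 = Re (cinner_ell2 (\<pi> (1 - star a * a) x) x)"
    by (simp add: norm_rep_apply_sq linear_diff[OF linear_rep] rep_one blinfun.diff_left
        cinner_ell2.diff_left cinner_ell2_self)
  also have "\<dots> = (norm (\<pi> b x))\<^sup>2"
    by (simp add: norm_rep_apply_sq b)
  finally have "(norm (\<pi> a x))\<^sup>2 \<le> (norm x)\<^sup>2"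
    using zero_le_power2[of "norm (\<pi> b x)"] by linarith
  then show ?thesis
    by (rule power2_le_imp_le) simp
qed

lemma norm_rep_le: "norm (\<pi> a) \<le> norm a"
proof (rule dense_ge)
  fix r
  assume r: "norm a < r"
  then have r0: "0 < r"
    by (rule order_le_less_trans[OF norm_ge_zero])
  show "norm (\<pi> a) \<le> r"
  proof (rule norm_blinfun_bound)
    fix x
    have "norm (\<pi> (inverse r *\<^sub>R a) x) \<le> norm x"
      using r r0 by (intro norm_rep_apply_le_of_norm_less_one) (simp add: field_simps)
    then show "norm (\<pi> a x) \<le> r * norm x"
      using r0 by (simp add: rep_scaleR blinfun.scaleR_left field_simps)
  qed (use r0 in simp)
qed

lemma bounded_linear_rep: "bounded_linear \<pi>"
  by (rule bounded_linear_intro[where K = 1])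
    (simp_all add: rep_add rep_scaleR norm_rep_le)

end

section \<open>Subalgebras detected by a generating set\<close>

lemma cstar_generates_subalgebraD:
  assumes "cstar_generates K" "cstar_subalgebra B" "K \<subseteq> B" "1 \<in> B"
  shows "a \<in> B"
proof -
  have "cstar_subalgebra hull (K \<union> {1}) \<subseteq> B"
    using assms by (intro hull_minimal) auto
  then show ?thesis
    using assms(1) by (auto simp: cstar_generates_def)
qed

text \<open>Closure under multiplication and under the star both come from estimates on
  \<open>\<pi>\<^sub>m(a) - \<pi>\<^sub>n(a)\<close>: the sequence \<open>\<pi>\<^sub>n(a)\<close> is bounded, and taking adjoints does not increase norms.
  Closedness is the usual \<open>\<epsilon>/3\<close> argument, with contractivity as the bound uniform in \<open>n\<close>.\<close>

lemma cstar_subalgebra_Cauchy: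
  fixes \<pi> :: "nat \<Rightarrow> 'a::unital_cstar_algebra \<Rightarrow> (ell2 \<Rightarrow>\<^sub>L ell2)"
  assumes rep: "\<And>n. \<pi> n \<in> Rep"
  shows "cstar_subalgebra {a. Cauchy (\<lambda>n. \<pi> n a)}"
proof -
  note conv = Cauchy_convergent_iff
  have zero: "Cauchy (\<lambda>n. \<pi> n 0)"
    by (simp add: linear_0[OF linear_rep[OF rep]] conv convergent_const)
  have add: "Cauchy (\<lambda>n. \<pi> n (a + b))" if "Cauchy (\<lambda>n. \<pi> n a)" "Cauchy (\<lambda>n. \<pi> n b)" for a b
    using that by (simp add: rep_add[OF rep] conv convergent_add)
  have mult: "Cauchy (\<lambda>n. \<pi> n (a * b))" if ab: "Cauchy (\<lambda>n. \<pi> n a)" "Cauchy (\<lambda>n. \<pi> n b)" for a b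
  proof -
    obtain L M where "(\<lambda>n. \<pi> n a) \<longlonglongrightarrow> L" "(\<lambda>n. \<pi> n b) \<longlonglongrightarrow> M"
      using ab unfolding conv convergent_def by blast
    then have "(\<lambda>n. \<pi> n (a * b)) \<longlonglongrightarrow> (L o\<^sub>L M)"
      unfolding rep_mult[OF rep]
      by (rule bounded_bilinear.tendsto[OF bounded_bilinear_blinfun_compose])
    then show ?thesis
      unfolding conv convergent_def by blast
  qed
  have scale: "Cauchy (\<lambda>n. \<pi> n (c *\<^sub>C a))" if "Cauchy (\<lambda>n. \<pi> n a)" for c a
  proof -
    \<comment> \<open>Complex multiples reduce to products: \<open>c a = (c 1) a\<close>, and every representation sends \<open>c 1\<close>
      to the same operator \<open>c I\<close>.\<close>
    have "\<pi> n (c *\<^sub>C 1) = \<pi> 0 (c *\<^sub>C 1)" for n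
      by (rule blinfun_eqI) (simp add: rep_scaleC[OF rep] rep_one[OF rep])
    then have "(\<lambda>n. \<pi> n (c *\<^sub>C 1)) = (\<lambda>_. \<pi> 0 (c *\<^sub>C 1))"
      by (rule ext)
    then have "Cauchy (\<lambda>n. \<pi> n (c *\<^sub>C 1))"
      by (simp only: conv convergent_const)
    from mult[OF this that] show ?thesis
      by (simp add: scaleC_mult_left)
  qed
  have star: "Cauchy (\<lambda>n. \<pi> n (star a))" if "Cauchy (\<lambda>n. \<pi> n a)" for a
  proof (rule metric_CauchyI)
    fix e :: real
    assume "e > 0"
    with that obtain M where "\<forall>m\<ge>M. \<forall>n\<ge>M. dist (\<pi> m a) (\<pi> n a) < e"
      unfolding Cauchy_def by blast
    moreover have "dist (\<pi> m (star a)) (\<pi> n (star a)) \<le> dist (\<pi> m a) (\<pi> n a)" for m n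
      unfolding dist_norm by (intro norm_adjoint_le is_adjoint_diff rep_star rep)
    ultimately show "\<exists>M. \<forall>m\<ge>M. \<forall>n\<ge>M. dist (\<pi> m (star a)) (\<pi> n (star a)) < e"
      by (meson order_le_less_trans)
  qed
  have closed: "closed {a. Cauchy (\<lambda>n. \<pi> n a)}"
  proof (rule closed_sequential_limits[THEN iffD2], intro allI impI, elim conjE)
    fix x l
    assume x: "\<forall>k. x k \<in> {a. Cauchy (\<lambda>n. \<pi> n a)}" and l: "x \<longlonglongrightarrow> l"
    have "Cauchy (\<lambda>n. \<pi> n l)"
    proof (rule metric_CauchyI)
      fix e :: real
      assume e: "e > 0"
      then have "\<forall>\<^sub>F k in sequentially. dist (x k) l < e / 3"
        using l by (intro tendstoD) auto
      then obtain k where k: "dist (x k) l < e / 3"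
        using eventually_happens'[OF sequentially_bot] by blast
      obtain M where M: "\<forall>m\<ge>M. \<forall>n\<ge>M. dist (\<pi> m (x k)) (\<pi> n (x k)) < e / 3"
        using metric_CauchyD[of "\<lambda>n. \<pi> n (x k)" "e / 3"] x e by auto
      have near: "dist (\<pi> n (x k)) (\<pi> n l) < e / 3" for n
        using k norm_rep_le[OF rep, of n "x k - l"]
        by (simp add: dist_norm linear_diff[OF linear_rep[OF rep]])
      have "dist (\<pi> m l) (\<pi> n l) < e" if "m \<ge> M" "n \<ge> M" for m n
        using near[of m] near[of n] M that
        by (intro dist_triangle_third[of "\<pi> m l" "\<pi> m (x k)" e "\<pi> n (x k)"])
          (simp_all add: dist_commute)
      then show "\<exists>M. \<forall>m\<ge>M. \<forall>n\<ge>M. dist (\<pi> m l) (\<pi> n l) < e"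
        by blast
    qed
    then show "l \<in> {a. Cauchy (\<lambda>n. \<pi> n a)}" by simp
  qed
  show ?thesis
    unfolding cstar_subalgebra_def using zero add mult scale star closed by simp
qed

lemma cstar_subalgebra_agree:
  assumes rep: "\<pi> \<in> Rep" "\<rho> \<in> Rep"
  shows "cstar_subalgebra {a. \<pi> a = \<rho> a}"
proof -
  have "\<pi> (star a) = \<rho> (star a)" if "\<pi> a = \<rho> a" for a
    using norm_adjoint_le[OF is_adjoint_diff[OF rep_star[OF rep(1), of a] rep_star[OF rep(2), of a]]]
      that by simp
  moreover have "\<pi> (c *\<^sub>C a) = \<rho> (c *\<^sub>C a)" if "\<pi> a = \<rho> a" for a c
    by (rule blinfun_eqI) (simp add: rep_scaleC rep that)
  moreover have "closed {a. \<pi> a = \<rho> a}"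
    by (intro closed_Collect_eq linear_continuous_on bounded_linear_rep rep)
  ultimately show ?thesis
    by (simp add: cstar_subalgebra_def rep_add rep_mult rep linear_0[OF linear_rep])
qed

lemma Rep_pointwise_limit:
  assumes rep: "\<And>n. \<pi> n \<in> Rep" and lim: "\<And>a. (\<lambda>n. \<pi> n a) \<longlonglongrightarrow> \<rho> a"
  shows "\<rho> \<in> Rep"
proof -
  note apply_lim = bounded_bilinear.tendsto[OF bounded_bilinear_blinfun_apply lim tendsto_const]
  have scaleC_lim: "(\<lambda>n. c *\<^sub>C X n) \<longlonglongrightarrow> c *\<^sub>C l" if "X \<longlonglongrightarrow> l" for c X and l :: ell2
  proof (rule bounded_linear.tendsto[OF _ that])
    show "bounded_linear (\<lambda>x :: ell2. c *\<^sub>C x)"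
      by (rule bounded_linear_intro[where K = "cmod c"])
        (simp_all add: scaleC_add_right scaleR_scaleC scaleC_scaleC norm_scaleC mult.commute)
  qed
  have "\<rho> a (c *\<^sub>C x) = c *\<^sub>C \<rho> a x" for a c x
    using apply_lim[of a "c *\<^sub>C x"] scaleC_lim[OF apply_lim[of a x], of c]
      rep_bounded_operators[OF rep]
    by (intro LIMSEQ_unique) (simp_all add: bounded_operators_def)
  moreover have "\<rho> (a + b) = \<rho> a + \<rho> b" for a b
    using lim[of "a + b"] tendsto_add[OF lim[of a] lim[of b]]
    by (intro LIMSEQ_unique) (simp_all add: rep_add[OF rep])
  moreover have "\<rho> (c *\<^sub>C a) x = c *\<^sub>C \<rho> a x" for a c x
    using apply_lim[of "c *\<^sub>C a" x] scaleC_lim[OF apply_lim[of a x], of c]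
    by (intro LIMSEQ_unique) (simp_all add: rep_scaleC[OF rep])
  moreover have "\<rho> (a * b) = \<rho> a o\<^sub>L \<rho> b" for a b
    using lim[of "a * b"]
      bounded_bilinear.tendsto[OF bounded_bilinear_blinfun_compose lim[of a] lim[of b]]
    by (intro LIMSEQ_unique) (simp_all add: rep_mult[OF rep])
  moreover have "cinner_ell2 (\<rho> a x) y = cinner_ell2 x (\<rho> (star a) y)" for a x y
    using cinner_ell2.tendsto[OF apply_lim[of a x] tendsto_const[of y]]
      cinner_ell2.tendsto[OF tendsto_const[of x] apply_lim[of "star a" y]]
      rep_star[OF rep, unfolded is_adjoint_def]
    by (intro LIMSEQ_unique) simp_all
  moreover have "\<rho> 1 = id_blinfun"
    using lim[of 1] by (simp add: rep_one[OF rep] LIMSEQ_const_iff)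
  ultimately show ?thesis
    by (simp add: Rep_def bounded_operators_def is_adjoint_def)
qed

section \<open>The metric of uniform convergence on a generating set\<close>

lemma rep_dist_finite:
  assumes K: "bounded K" and rep: "\<pi> \<in> Rep" "\<rho> \<in> Rep"
  shows "rep_dist K \<pi> \<rho> < \<infinity>"
proof -
  obtain B where B: "\<And>a. a \<in> K \<Longrightarrow> norm a \<le> B"
    using K by (auto simp: bounded_iff)
  have "norm (\<pi> a - \<rho> a) \<le> 2 * B" if "a \<in> K" for a
    using norm_triangle_ineq4[of "\<pi> a" "\<rho> a"] norm_rep_le[OF rep(1), of a]
      norm_rep_le[OF rep(2), of a] B[OF that] by linarith
  then have "rep_dist K \<pi> \<rho> \<le> ennreal (2 * B)"
    unfolding rep_dist_def by (intro SUP_least ennreal_leI)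
  also have "\<dots> < \<infinity>"
    by simp
  finally show ?thesis .
qed

lemma norm_diff_le_rep_dist:
  assumes "bounded K" "\<pi> \<in> Rep" "\<rho> \<in> Rep" "a \<in> K"
  shows "norm (\<pi> a - \<rho> a) \<le> enn2real (rep_dist K \<pi> \<rho>)"
proof -
  have "ennreal (norm (\<pi> a - \<rho> a)) \<le> rep_dist K \<pi> \<rho>"
    unfolding rep_dist_def using assms by (intro SUP_upper)
  then have "enn2real (ennreal (norm (\<pi> a - \<rho> a))) \<le> enn2real (rep_dist K \<pi> \<rho>)"
    using rep_dist_finite[OF assms(1-3)] by (intro enn2real_mono) simp_all
  then show ?thesis
    by simp
qed

lemma rep_dist_le:
  assumes "0 \<le> e" "\<And>a. a \<in> K \<Longrightarrow> norm (\<pi> a - \<rho> a) \<le> e"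
  shows "enn2real (rep_dist K \<pi> \<rho>) \<le> e"
  unfolding rep_dist_def using assms by (intro enn2real_leI SUP_least ennreal_leI)

lemma Metric_space_rep_dist:
  assumes K: "bounded K" and gen: "cstar_generates K"
  shows "Metric_space Rep (\<lambda>\<pi> \<rho>. enn2real (rep_dist K \<pi> \<rho>))"
proof
  fix \<pi> \<rho> \<sigma> :: "'a \<Rightarrow> (ell2 \<Rightarrow>\<^sub>L ell2)"
  show "0 \<le> enn2real (rep_dist K \<pi> \<rho>)"
    by simp
  show "enn2real (rep_dist K \<pi> \<rho>) = enn2real (rep_dist K \<rho> \<pi>)"
    by (simp add: rep_dist_def norm_minus_commute)
  assume rep: "\<pi> \<in> Rep" "\<rho> \<in> Rep"
  show "enn2real (rep_dist K \<pi> \<rho>) = 0 \<longleftrightarrow> \<pi> = \<rho>"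
  proof
    assume "enn2real (rep_dist K \<pi> \<rho>) = 0"
    then have "K \<subseteq> {a. \<pi> a = \<rho> a}"
      using norm_diff_le_rep_dist[OF K rep] by auto
    then have "a \<in> {a. \<pi> a = \<rho> a}" for a
      by (rule cstar_generates_subalgebraD[OF gen cstar_subalgebra_agree[OF rep]])
        (simp add: rep_one rep)
    then show "\<pi> = \<rho>" by auto
  next
    assume "\<pi> = \<rho>"
    then have "enn2real (rep_dist K \<pi> \<rho>) \<le> 0"
      by (intro rep_dist_le) simp_all
    then show "enn2real (rep_dist K \<pi> \<rho>) = 0"
      by (simp add: antisym)
  qed
  assume \<sigma>: "\<sigma> \<in> Rep"
  show "enn2real (rep_dist K \<pi> \<sigma>) \<le> enn2real (rep_dist K \<pi> \<rho>) + enn2real (rep_dist K \<rho> \<sigma>)"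
  proof (rule rep_dist_le)
    fix a
    assume a: "a \<in> K"
    have "norm (\<pi> a - \<sigma> a) \<le> norm (\<pi> a - \<rho> a) + norm (\<rho> a - \<sigma> a)"
      using dist_triangle[of "\<pi> a" "\<sigma> a" "\<rho> a"] by (simp add: dist_norm)
    then show "norm (\<pi> a - \<sigma> a) \<le> enn2real (rep_dist K \<pi> \<rho>) + enn2real (rep_dist K \<rho> \<sigma>)"
      using norm_diff_le_rep_dist[OF K rep a] norm_diff_le_rep_dist[OF K rep(2) \<sigma> a] by linarith
  qed simp
qed

text \<open>The Cauchy condition for \<open>d\<^sub>K\<close> is uniform in \<open>a \<in> K\<close>, so letting \<open>m\<close> tend to infinity in
  \<open>\<parallel>\<pi>\<^sub>n(a) - \<pi>\<^sub>m(a)\<parallel> \<le> \<epsilon>\<close> upgrades pointwise convergence on the algebra to convergence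
  in \<open>d\<^sub>K\<close>.\<close>

lemma mcomplete_rep_dist:
  assumes K: "bounded K" and gen: "cstar_generates K"
  shows "Metric_space.mcomplete Rep (\<lambda>\<pi> \<rho>. enn2real (rep_dist K \<pi> \<rho>))"
proof -
  interpret Metric_space Rep "\<lambda>\<pi> \<rho>. enn2real (rep_dist K \<pi> \<rho>)"
    by (rule Metric_space_rep_dist[OF K gen])
  show ?thesis
    unfolding mcomplete_def
  proof (intro allI impI)
    fix \<pi> :: "nat \<Rightarrow> 'a \<Rightarrow> (ell2 \<Rightarrow>\<^sub>L ell2)"
    assume Cau: "MCauchy \<pi>"
    then have rep: "\<pi> n \<in> Rep" for n
      by (auto simp: MCauchy_def)
    have unif: "\<exists>N. \<forall>n\<ge>N. \<forall>m\<ge>N. \<forall>a\<in>K. norm (\<pi> n a - \<pi> m a) < e" if "e > 0" for e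
      using Cau that norm_diff_le_rep_dist[OF K rep rep]
      unfolding MCauchy_def by (meson order_le_less_trans)
    have "K \<subseteq> {a. Cauchy (\<lambda>n. \<pi> n a)}"
      using unif unfolding Cauchy_def dist_norm by blast
    moreover have "Cauchy (\<lambda>n. \<pi> n 1)"
      by (simp add: rep_one[OF rep] Cauchy_convergent_iff convergent_const)
    ultimately have "Cauchy (\<lambda>n. \<pi> n a)" for a
      using cstar_generates_subalgebraD[OF gen cstar_subalgebra_Cauchy[where \<pi> = \<pi>, OF rep]]
      by simp
    then obtain \<rho> where \<rho>: "\<And>a. (\<lambda>n. \<pi> n a) \<longlonglongrightarrow> \<rho> a"
      unfolding Cauchy_convergent_iff convergent_def by metis
    have \<rho>_rep: "\<rho> \<in> Rep"
      by (rule Rep_pointwise_limit[OF rep \<rho>])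
    have "\<exists>N. \<forall>n\<ge>N. \<pi> n \<in> Rep \<and> enn2real (rep_dist K (\<pi> n) \<rho>) < e" if e: "e > 0" for e
    proof -
      obtain N where N: "\<forall>n\<ge>N. \<forall>m\<ge>N. \<forall>a\<in>K. norm (\<pi> n a - \<pi> m a) < e / 2"
        using unif[of "e / 2"] e by auto
      have "enn2real (rep_dist K (\<pi> n) \<rho>) \<le> e / 2" if n: "n \<ge> N" for n
      proof (rule rep_dist_le)
        fix a
        assume "a \<in> K"
        with N n have "\<forall>m\<ge>N. norm (\<pi> n a - \<pi> m a) \<le> e / 2"
          by (meson less_imp_le)
        then show "norm (\<pi> n a - \<rho> a) \<le> e / 2"
          by (intro LIMSEQ_le_const2[OF tendsto_norm[OF tendsto_diff[OF tendsto_const \<rho>]]]) blast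
      qed (use e in simp)
      moreover have "e / 2 < e"
        using e by simp
      ultimately show ?thesis
        using rep order_le_less_trans by blast
    qed
    then show "\<exists>\<rho>. limitin mtopology \<pi> \<rho> sequentially"
      using \<rho>_rep by (auto simp: limit_metric_sequentially)
  qed
qed

theorem theorem4p3:
  fixes K :: "'a::unital_cstar_algebra set"
  assumes separable: "\<exists>D :: 'a set. countable D \<and> closure D = UNIV"
    and compact: "compact K"
    and generates: "cstar_generates K"
  shows "(\<forall>\<pi>\<^sub>1\<in>Rep. \<forall>\<pi>\<^sub>2\<in>Rep. rep_dist K \<pi>\<^sub>1 \<pi>\<^sub>2 < \<infinity>) \<and>
         Metric_space Rep (\<lambda>\<pi>\<^sub>1 \<pi>\<^sub>2. enn2real (rep_dist K \<pi>\<^sub>1 \<pi>\<^sub>2)) \<and>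
         Metric_space.mcomplete Rep (\<lambda>\<pi>\<^sub>1 \<pi>\<^sub>2. enn2real (rep_dist K \<pi>\<^sub>1 \<pi>\<^sub>2))"
  using compact_imp_bounded[OF compact] generates
  by (blast intro: rep_dist_finite Metric_space_rep_dist mcomplete_rep_dist)

end
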